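(* Up to equivalence there are exactly four complete extended systems: $\mathbf{GS1p}$, $\mathbf{Pp}$, $\mathbf{Np}$ and $\mathbf{Mp}$. That is, each of these is a complete extended system, and every complete extended system is equivalent to one of them.
   Context: Formulas are built from literals (propositional variables $P$ and their complements $\bar P$) using $\wedge$ and $\vee$. Negation satisfies $\neg P=\bar P$ and is extended by De Morgan's laws. A sequent is a nonempty finite multiset of formulas. A comma denotes multiset union, and $\Gamma,\Delta,\Sigma$ denote possibly empty multisets. A formula is valid if it evaluates to $1$ under every $0/1$-assignment. Rules: - Axiom: infer $P,\neg P$ from no premises. - $(\&)$: from $\Gamma,A$ and $\Gamma,B$ infer $\Gamma,A\wedge B$. - $(\otimes)$: from $\Delta,A$ and $\Sigma,B$ infer $\Delta,\Sigma,A\wedge B$. - $(\wedge)$: from $\Gamma,\Delta,A$ and $\Gamma,\Sigma,B$ infer $\Gamma,\Delta,\Sigma,A\wedge B$. - $(\oplus)$: consists of both $(\oplus_1)$ and $(\oplus_2)$, where $(\oplus_i)$ infers $\Gamma,A_1\vee A_2$ from $\Gamma,A_i$. - $(\mathrm{par})$: from $\Gamma,A,B$ infer $\Gamma,A\vee B$. - $(\mathsf W)$: from $\Gamma$ infer $\Gamma,A$. - $(\mathsf C)$: from $\Gamma,A,A$ infer $\Gamma,A$. An extended system is the axiom together with any subset of $\{(\otimes),(\wedge),(\&),(\oplus),(\mathrm{par}),(\mathsf C),(\mathsf W)\}$. The named systems are: - $\mathbf{GS1p}$ = axiom + $(\&),(\oplus),(\mathsf W),(\mathsf C)$; - $\mathbf{Pp}$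 = axiom + $(\otimes),(\oplus),(\mathsf C)$; - $\mathbf{Np}$ = axiom + $(\&),(\mathrm{par}),(\mathsf W)$; - $\mathbf{Mp}$ = axiom + $(\wedge),(\oplus),(\mathrm{par})$. A rule is derivable in $S$ if, for every instance of it, the conclusion is derivable in $S$ from its premises used as extra leaves. $S$ contains $T$ if every rule of $T$ is derivable in $S$. Two systems are equivalent if each contains the other. A system is complete if every valid formula is derivable in it. *)

theory Defs
  imports "HOL-Library.Multiset"
begin

text \<open>Propositional variables are drawn from a countably infinite supply, represented by
  the natural numbers.\<close>

type_synonym var = nat

datatype formula =
    Pos var
  | Neg var
  | And formula formula
  | Or formula formula

fun neg :: "formula \<Rightarrow> formula" where
  "neg (Pos p) = Neg p"
| "neg (Neg p) = Pos p"
| "neg (And A B) = Or (neg A) (neg B)"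
| "neg (Or A B) = And (neg A) (neg B)"

fun holds :: "(var \<Rightarrow> bool) \<Rightarrow> formula \<Rightarrow> bool" where
  "holds v (Pos p) \<longleftrightarrow> v p"
| "holds v (Neg p) \<longleftrightarrow> \<not> v p"
| "holds v (And A B) \<longleftrightarrow> holds v A \<and> holds v B"
| "holds v (Or A B) \<longleftrightarrow> holds v A \<or> holds v B"

definition valid :: "formula \<Rightarrow> bool" where
  "valid A \<longleftrightarrow> (\<forall>v. holds v A)"

text \<open>Sequents are the nonempty finite multisets of formulas. The type contains the empty
  multiset as well, but nonemptiness is enforced by the rule instances below: every premise and
  conclusion is nonempty by its form, except for the premise of weakening, where nonemptiness
  is a side condition.\<close>

type_synonym sequent = "formula multiset"

datatype rule_name = Ax | Tensor | Wedge | With | Plus | Par | Contr | Weak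

text \<open>\<open>rule_inst r Ps S\<close>: the rule \<open>r\<close> has an instance with list of premises \<open>Ps\<close>
  and conclusion \<open>S\<close>.\<close>

inductive rule_inst :: "rule_name \<Rightarrow> sequent list \<Rightarrow> sequent \<Rightarrow> bool" where
  ax: "rule_inst Ax [] {#Pos p, neg (Pos p)#}"
| tensor: "rule_inst Tensor [\<Delta> + {#A#}, \<Sigma> + {#B#}] (\<Delta> + \<Sigma> + {#And A B#})"
| wedge: "rule_inst Wedge [\<Gamma> + \<Delta> + {#A#}, \<Gamma> + \<Sigma> + {#B#}] (\<Gamma> + \<Delta> + \<Sigma> + {#And A B#})"
| with_and: "rule_inst With [\<Gamma> + {#A#}, \<Gamma> + {#B#}] (\<Gamma> + {#And A B#})"
| plus1: "rule_inst Plus [\<Gamma> + {#A#}] (\<Gamma> + {#Or A B#})"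
| plus2: "rule_inst Plus [\<Gamma> + {#B#}] (\<Gamma> + {#Or A B#})"
| par: "rule_inst Par [\<Gamma> + {#A, B#}] (\<Gamma> + {#Or A B#})"
| contr: "rule_inst Contr [\<Gamma> + {#A, A#}] (\<Gamma> + {#A#})"
| weak: "\<Gamma> \<noteq> {#} \<Longrightarrow> rule_inst Weak [\<Gamma>] (\<Gamma> + {#A#})"

type_synonym system = "rule_name set"

definition extended_system :: "system \<Rightarrow> bool" where
  "extended_system S \<longleftrightarrow>
     (\<exists>R \<subseteq> {Tensor, Wedge, With, Plus, Par, Contr, Weak}. S = insert Ax R)"

definition GS1p :: system where "GS1p = {Ax, With, Plus, Weak, Contr}"
definition Pp :: system where "Pp = {Ax, Tensor, Plus, Contr}"
definition Np :: system where "Np = {Ax, With, Par, Weak}"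
definition Mp :: system where "Mp = {Ax, Wedge, Plus, Par}"

text \<open>Derivability in \<open>S\<close> with the sequents in \<open>L\<close> admitted as additional leaves, each of
  which may be used any number of times.\<close>

inductive derives :: "system \<Rightarrow> sequent set \<Rightarrow> sequent \<Rightarrow> bool"
  for S :: system and L :: "sequent set" where
  leaf: "\<Gamma> \<in> L \<Longrightarrow> derives S L \<Gamma>"
| step: "r \<in> S \<Longrightarrow> rule_inst r Ps \<Gamma> \<Longrightarrow> (\<And>P. P \<in> set Ps \<Longrightarrow> derives S L P) \<Longrightarrow> derives S L \<Gamma>"

definition rule_derivable :: "system \<Rightarrow> rule_name \<Rightarrow> bool" where
  "rule_derivable S r \<longleftrightarrow> (\<forall>Ps \<Gamma>. rule_inst r Ps \<Gamma> \<longrightarrow> derives S (set Ps) \<Gamma>)"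

definition contains :: "system \<Rightarrow> system \<Rightarrow> bool" where
  "contains S T \<longleftrightarrow> (\<forall>r \<in> T. rule_derivable S r)"

definition equivalent :: "system \<Rightarrow> system \<Rightarrow> bool" where
  "equivalent S T \<longleftrightarrow> contains S T \<and> contains T S"

definition complete_system :: "system \<Rightarrow> bool" where
  "complete_system S \<longleftrightarrow> (\<forall>A. valid A \<longrightarrow> derives S {} {#A#})"

end

theory Submission
  imports Defs
begin

text \<open>
  \<open>Mp\<close> is complete because every valid sequent has a derivable sub-multiset: descending through
  the connectives, the contexts that the two premises of a conjunction share are merged by
  \<open>Wedge\<close>, and a disjunct missing from the sub-multiset is supplied by \<open>Plus\<close>.
  Conversely every complete system derives \<open>Plus\<close>, \<open>Par\<close> and \<open>Wedge\<close>, since it is contained in none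
  of seven incomplete systems. Hence, up to equivalence, it is determined by which of contraction
  and weakening it has, and neither of these is derivable from the other rules.
\<close>

section \<open>Derivability and containment\<close>

lemma derives_cut:
  assumes "derives S L \<Gamma>" and "\<And>\<Delta>. \<Delta> \<in> L \<Longrightarrow> derives S L' \<Delta>"
  shows "derives S L' \<Gamma>"
  using assms by (induction rule: derives.induct) (auto intro: derives.intros)

text \<open>Serves every underivability result below: an invariant holds of the leaves and passes
  through the rules of \<open>S\<close>, but fails at the target sequent.\<close>

lemma derives_invariant:
  assumes "derives S L \<Gamma>" and "\<And>\<Delta>. \<Delta> \<in> L \<Longrightarrow> I \<Delta>"
    and "\<And>r Ps \<Delta>. r \<in> S \<Longrightarrow> rule_inst r Ps \<Delta> \<Longrightarrow> (\<And>P. P \<in> set Ps \<Longrightarrow> I P) \<Longrightarrow> I \<Delta>"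
  shows "I \<Gamma>"
  using assms by (induction rule: derives.induct) metis+

lemma rule_derivableI:
  "(\<And>Ps \<Gamma>. rule_inst r Ps \<Gamma> \<Longrightarrow> derives S (set Ps) \<Gamma>) \<Longrightarrow> rule_derivable S r"
  by (simp add: rule_derivable_def)

lemma derives_rule:
  assumes "rule_derivable S r" and "rule_inst r Ps \<Gamma>" and "\<forall>P \<in> set Ps. derives S L P"
  shows "derives S L \<Gamma>"
  using assms derives_cut unfolding rule_derivable_def by blast

lemma rule_derivable_member: "r \<in> S \<Longrightarrow> rule_derivable S r"
  by (auto simp: rule_derivable_def intro: derives.intros)

lemma contains_derives:
  assumes "derives T L \<Gamma>" and "contains S T"
  shows "derives S L \<Gamma>"
  using assms
proof (induction rule: derives.induct)
  case (leaf \<Gamma>)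
  then show ?case by (simp add: derives.leaf)
next
  case (step r Ps \<Gamma>)
  then show ?case by (meson contains_def derives_rule)
qed

lemma contains_complete: "contains S T \<Longrightarrow> complete_system T \<Longrightarrow> complete_system S"
  using contains_derives by (auto simp: complete_system_def)

section \<open>Derivable rules\<close>

lemma tensor_from_wedge:
  assumes "rule_derivable S Wedge"
  shows "rule_derivable S Tensor"
proof (rule rule_derivableI)
  fix Ps \<Gamma> assume "rule_inst Tensor Ps \<Gamma>"
  then show "derives S (set Ps) \<Gamma>"
  proof cases
    case (tensor \<Delta> A \<Sigma> B)
    then show ?thesis
      using derives_rule[OF assms rule_inst.wedge[of "{#}" \<Delta> A \<Sigma> B]] by (simp add: derives.leaf)
  qed
qed

lemma with_from_wedge:
  assumes "rule_derivable S Wedge"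
  shows "rule_derivable S With"
proof (rule rule_derivableI)
  fix Ps \<Gamma> assume "rule_inst With Ps \<Gamma>"
  then show "derives S (set Ps) \<Gamma>"
  proof cases
    case (with_and \<Delta> A B)
    then show ?thesis
      using derives_rule[OF assms rule_inst.wedge[of \<Delta> "{#}" A "{#}" B]] by (simp add: derives.leaf)
  qed
qed

lemma derives_weaken:
  assumes "rule_derivable S Weak" and "derives S L \<Gamma>" and "\<Gamma> \<noteq> {#}"
  shows "derives S L (\<Gamma> + \<Delta>)"
proof (induction \<Delta>)
  case empty
  then show ?case using assms by simp
next
  case (add A \<Delta>)
  then show ?case
    using derives_rule[OF assms(1) rule_inst.weak[of "\<Gamma> + \<Delta>" A]] assms(3) by simp
qed

lemma derives_contract:
  assumes "rule_derivable S Contr" and "derives S L (\<Gamma> + \<Gamma> + \<Delta>)"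
  shows "derives S L (\<Gamma> + \<Delta>)"
  using assms(2)
proof (induction \<Gamma> arbitrary: \<Delta>)
  case empty
  then show ?case by simp
next
  case (add A \<Gamma>)
  have "derives S L (\<Gamma> + \<Gamma> + \<Delta> + {#A#})"
    using derives_rule[OF assms(1) rule_inst.contr[of "\<Gamma> + \<Gamma> + \<Delta>" A]] add.prems by simp
  \<comment> \<open>The surviving copy of \<open>A\<close> moves into the context, hence the
    induction over arbitrary \<open>\<Delta>\<close>.\<close>
  then show ?case using add.IH[of "add_mset A \<Delta>"] by simp
qed

text \<open>Weakening brings both premises to the common context
  \<open>\<Gamma> + \<Delta> + \<Sigma>\<close>.\<close>

lemma wedge_from_with_weak:
  assumes "rule_derivable S With" and "rule_derivable S Weak"
  shows "rule_derivable S Wedge"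
proof (rule rule_derivableI)
  fix Ps \<Theta> assume "rule_inst Wedge Ps \<Theta>"
  then show "derives S (set Ps) \<Theta>"
  proof cases
    case (wedge \<Gamma> \<Delta> A \<Sigma> B)
    have "derives S (set Ps) ((\<Gamma> + \<Delta> + {#A#}) + \<Sigma>)" "derives S (set Ps) ((\<Gamma> + \<Sigma> + {#B#}) + \<Delta>)"
      by (rule derives_weaken[OF assms(2)]; simp add: wedge derives.leaf)+
    then show ?thesis
      using wedge derives_rule[OF assms(1) rule_inst.with_and[of "\<Gamma> + \<Delta> + \<Sigma>" A B]]
      by (simp add: ac_simps)
  qed
qed

text \<open>\<open>Tensor\<close> leaves two copies of the shared context, which contraction
  merges.\<close>

lemma wedge_from_tensor_contr:
  assumes "rule_derivable S Tensor" and "rule_derivable S Contr"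
  shows "rule_derivable S Wedge"
proof (rule rule_derivableI)
  fix Ps \<Theta> assume "rule_inst Wedge Ps \<Theta>"
  then show "derives S (set Ps) \<Theta>"
  proof cases
    case (wedge \<Gamma> \<Delta> A \<Sigma> B)
    have "derives S (set Ps) (\<Gamma> + \<Gamma> + (\<Delta> + \<Sigma> + {#And A B#}))"
      using wedge derives_rule[OF assms(1) rule_inst.tensor[of "\<Gamma> + \<Delta>" A "\<Gamma> + \<Sigma>" B]]
      by (simp add: ac_simps derives.leaf)
    then show ?thesis
      using wedge derives_contract[OF assms(2), of "set Ps" \<Gamma> "\<Delta> + \<Sigma> + {#And A B#}"]
      by (simp add: ac_simps)
  qed
qed

lemma plus_from_par_weak:
  assumes "rule_derivable S Par" and "rule_derivable S Weak"
  shows "rule_derivable S Plus"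
proof (rule rule_derivableI)
  fix Ps \<Theta> assume inst: "rule_inst Plus Ps \<Theta>"
  have *: "derives S (set Ps) (\<Gamma> + {#Or A B#})"
    if "C = A \<or> C = B" and "Ps = [\<Gamma> + {#C#}]" for \<Gamma> A B C
  proof -
    \<comment> \<open>The formula added is the other disjunct, also when
      \<open>A = B\<close>.\<close>
    have "derives S (set Ps) (\<Gamma> + {#C#} + {#if C = A then B else A#})"
      by (rule derives_weaken[OF assms(2)]) (simp_all add: that derives.leaf)
    with that have "derives S (set Ps) (\<Gamma> + {#A, B#})"
      by (auto split: if_splits simp: add_mset_commute)
    then show ?thesis using derives_rule[OF assms(1) rule_inst.par] by simp
  qed
  from inst show "derives S (set Ps) \<Theta>"
    by cases (use * in blast)+
qed

text \<open>Turning both disjuncts into \<open>Or A B\<close> leaves two copies to contract.\<close>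

lemma par_from_plus_contr:
  assumes "rule_derivable S Plus" and "rule_derivable S Contr"
  shows "rule_derivable S Par"
proof (rule rule_derivableI)
  fix Ps \<Theta> assume "rule_inst Par Ps \<Theta>"
  then show "derives S (set Ps) \<Theta>"
  proof cases
    case (par \<Gamma> A B)
    have "derives S (set Ps) (\<Gamma> + {#B#} + {#Or A B#})"
      using par derives_rule[OF assms(1) rule_inst.plus1[of "\<Gamma> + {#B#}" A B]]
      by (simp add: derives.leaf add_mset_commute)
    then have "derives S (set Ps) (\<Gamma> + {#Or A B#} + {#Or A B#})"
      using derives_rule[OF assms(1) rule_inst.plus2[of "\<Gamma> + {#Or A B#}" B A]]
      by (simp add: add_mset_commute)
    then show ?thesis using par derives_rule[OF assms(2) rule_inst.contr] by simp
  qed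
qed

lemma contains_Mp_iff:
  "contains S Mp \<longleftrightarrow>
     rule_derivable S Ax \<and> rule_derivable S Wedge \<and> rule_derivable S Plus \<and> rule_derivable S Par"
  by (auto simp: contains_def Mp_def)

text \<open>\<open>Wedge\<close> yields \<open>Tensor\<close> and \<open>With\<close>, so above
  \<open>Mp\<close> only the structural rules can tell systems apart.\<close>

lemma contains_if_contains_Mp:
  assumes "contains S Mp" and "T \<inter> {Contr, Weak} \<subseteq> S"
  shows "contains S T"
  unfolding contains_def
proof
  fix r assume "r \<in> T"
  then show "rule_derivable S r"
    using assms tensor_from_wedge with_from_wedge rule_derivable_member
    by (cases r) (auto simp: contains_Mp_iff)
qed

lemma contains_MpI:
  assumes "Ax \<in> S"
    and "Plus \<in> S \<or> Par \<in> S \<and> Weak \<in> S"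
    and "Par \<in> S \<or> Plus \<in> S \<and> Contr \<in> S"
    and "Wedge \<in> S \<or> With \<in> S \<and> Weak \<in> S \<or> Tensor \<in> S \<and> Contr \<in> S"
  shows "contains S Mp"
  using assms rule_derivable_member plus_from_par_weak par_from_plus_contr
    wedge_from_with_weak wedge_from_tensor_contr
  unfolding contains_Mp_iff by metis

section \<open>Completeness\<close>

text \<open>Conjunction, if \<open>a\<close> is false, and disjunction, if \<open>d\<close> is false, are reinterpreted as
  constantly false: this remains sound for systems without rules introducing them.\<close>

fun restricted_holds :: "bool \<Rightarrow> bool \<Rightarrow> (var \<Rightarrow> bool) \<Rightarrow> formula \<Rightarrow> bool" where
  "restricted_holds a d v (Pos p) \<longleftrightarrow> v p"
| "restricted_holds a d v (Neg p) \<longleftrightarrow> \<not> v p"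
| "restricted_holds a d v (And A B) \<longleftrightarrow> a \<and> restricted_holds a d v A \<and> restricted_holds a d v B"
| "restricted_holds a d v (Or A B) \<longleftrightarrow> d \<and> (restricted_holds a d v A \<or> restricted_holds a d v B)"

lemma restricted_holds_True: "restricted_holds True True v A = holds v A"
  by (induction A) auto

lemma restricted_rule_sound:
  assumes "rule_inst r Ps \<Gamma>"
    and "r \<in> {Tensor, Wedge, With} \<Longrightarrow> a" and "r \<in> {Plus, Par} \<Longrightarrow> d"
    and "\<And>P. P \<in> set Ps \<Longrightarrow> \<exists>A \<in># P. restricted_holds a d v A"
  shows "\<exists>A \<in># \<Gamma>. restricted_holds a d v A"
  using assms by cases fastforce+

lemma restricted_sound:
  assumes "derives S {} \<Gamma>"
    and "S \<inter> {Tensor, Wedge, With} = {} \<or> a" and "S \<inter> {Plus, Par} = {} \<or> d"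
  shows "\<exists>A \<in># \<Gamma>. restricted_holds a d v A"
  using assms(1)
proof (rule derives_invariant)
  fix r Ps \<Delta>
  assume "r \<in> S" and inst: "rule_inst r Ps \<Delta>"
    and prems: "\<And>P. P \<in> set Ps \<Longrightarrow> \<exists>A \<in># P. restricted_holds a d v A"
  with assms(2,3) show "\<exists>A \<in># \<Delta>. restricted_holds a d v A"
    by (intro restricted_rule_sound[OF inst _ _ prems]) auto
qed simp

definition valid_sequent :: "sequent \<Rightarrow> bool" where
  "valid_sequent \<Gamma> \<longleftrightarrow> (\<forall>v. \<exists>A \<in># \<Gamma>. holds v A)"

lemma rule_sound:
  "rule_inst r Ps \<Gamma> \<Longrightarrow> (\<And>P. P \<in> set Ps \<Longrightarrow> valid_sequent P) \<Longrightarrow> valid_sequent \<Gamma>"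
  using restricted_rule_sound[of r Ps \<Gamma> True True]
  by (auto simp: valid_sequent_def restricted_holds_True)

section \<open>Derivable subsequents in \<open>Mp\<close>\<close>

lemma subseteq_mset_snocE:
  assumes "\<Delta> \<subseteq># \<Gamma> + {#A#}"
  obtains "\<Delta> \<subseteq># \<Gamma>" | \<Delta>' where "\<Delta> = \<Delta>' + {#A#}" and "\<Delta>' \<subseteq># \<Gamma>"
proof (cases "A \<in># \<Delta>")
  case True
  then obtain \<Delta>' where "\<Delta> = \<Delta>' + {#A#}" by (metis add_mset_add_single insert_DiffM)
  with assms that(2) show ?thesis by simp
next
  case False
  with assms that(1) show ?thesis
    by (metis add_mset_add_single diff_single_trivial subset_eq_diff_conv)
qed

text \<open>The shared context is the multiset intersection. The resulting union takes maximal
  multiplicities, so it stays below every common bound of \<open>\<Delta>\<close> and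
  \<open>\<Sigma>\<close>, unlike their sum.\<close>

lemma derives_wedge_union:
  assumes "rule_derivable S Wedge" and "derives S L (\<Delta> + {#A#})" and "derives S L (\<Sigma> + {#B#})"
  shows "derives S L (\<Delta> \<union># \<Sigma> + {#And A B#})"
proof -
  have "\<Delta> \<inter># \<Sigma> + (\<Delta> - \<Sigma>) = \<Delta>" "\<Delta> \<inter># \<Sigma> + (\<Sigma> - \<Delta>) = \<Sigma>"
    "\<Delta> \<inter># \<Sigma> + (\<Delta> - \<Sigma>) + (\<Sigma> - \<Delta>) = \<Delta> \<union># \<Sigma>"
    by (auto intro!: multiset_eqI)
  then show ?thesis
    using derives_rule[OF assms(1) rule_inst.wedge[of "\<Delta> \<inter># \<Sigma>" "\<Delta> - \<Sigma>" A "\<Sigma> - \<Delta>" B]] assms(2,3)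
    by simp
qed

lemma valid_literals_contain_axiom:
  assumes "valid_sequent \<Gamma>" and "\<And>A. A \<in># \<Gamma> \<Longrightarrow> \<exists>p. A = Pos p \<or> A = Neg p"
  shows "\<exists>p. {#Pos p, Neg p#} \<subseteq># \<Gamma>"
proof -
  \<comment> \<open>This assignment falsifies every \<open>Neg p\<close> in \<open>\<Gamma>\<close>,
    so a literal it satisfies is some \<open>Pos p\<close> whose complement also occurs.\<close>
  obtain A where A: "A \<in># \<Gamma>" "holds (\<lambda>p. Neg p \<in># \<Gamma>) A"
    using assms(1) by (auto simp: valid_sequent_def)
  with assms(2) obtain p where "Pos p \<in># \<Gamma>" "Neg p \<in># \<Gamma>" by fastforce
  then have "{#Pos p, Neg p#} \<subseteq># \<Gamma>"
    by (simp add: insert_subset_eq_iff in_diff_count)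
  then show ?thesis ..
qed

text \<open>Allowing a subsequent makes up for the absence of weakening: formulas outside the axiom
  are dropped at the leaves.\<close>

lemma Mp_derives_subsequent:
  "valid_sequent \<Gamma> \<Longrightarrow> \<exists>\<Delta>. \<Delta> \<subseteq># \<Gamma> \<and> derives Mp {} \<Delta>"
proof (induction "\<Sum>A \<in># \<Gamma>. size A" arbitrary: \<Gamma> rule: less_induct)
  case less
  have Mp: "rule_derivable Mp Ax" "rule_derivable Mp Wedge" "rule_derivable Mp Plus" "rule_derivable Mp Par"
    by (simp_all add: Mp_def rule_derivable_member)
  consider (Or) A B \<Gamma>' where "\<Gamma> = \<Gamma>' + {#Or A B#}"
    | (And) A B \<Gamma>' where "\<Gamma> = \<Gamma>' + {#And A B#}"
    | (lit) "\<And>A. A \<in># \<Gamma> \<Longrightarrow> \<exists>p. A = Pos p \<or> A = Neg p"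
    by (metis add_mset_add_single formula.exhaust insert_DiffM)
  then show ?case
  proof cases
    case Or
    have "valid_sequent (\<Gamma>' + {#A#} + {#B#})"
      using less.prems by (auto simp: Or valid_sequent_def)
    then obtain \<Delta> where \<Delta>: "\<Delta> \<subseteq># \<Gamma>' + {#A#} + {#B#}" "derives Mp {} \<Delta>"
      using less.hyps[of "\<Gamma>' + {#A#} + {#B#}"] by (auto simp: Or)
    have plus: ?thesis if "\<Delta>' \<subseteq># \<Gamma>'" "\<Delta> = \<Delta>' + {#C#}" "C = A \<or> C = B" for \<Delta>' C
    proof -
      have "derives Mp {} (\<Delta>' + {#Or A B#})"
        using that \<Delta>(2) derives_rule[OF Mp(3) rule_inst.plus1] derives_rule[OF Mp(3) rule_inst.plus2]
        by auto
      then show ?thesis using that Or by (intro exI[of _ "\<Delta>' + {#Or A B#}"]) simp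
    qed
    \<comment> \<open>Whether \<open>B\<close>, and then \<open>A\<close>, was kept in
      \<open>\<Delta>\<close> decides between no rule, \<open>Plus\<close> and
      \<open>Par\<close>.\<close>
    from \<Delta>(1) show ?thesis
    proof (cases rule: subseteq_mset_snocE)
      case 1
      then show ?thesis
      proof (cases rule: subseteq_mset_snocE)
        case 1
        then show ?thesis
          using \<Delta>(2) Or by (metis mset_subset_eq_add_left subset_mset.order_trans)
      next
        case (2 \<Delta>')
        then show ?thesis using plus by blast
      qed
    next
      case B: (2 \<Delta>')
      from B(2) show ?thesis
      proof (cases rule: subseteq_mset_snocE)
        case 1
        then show ?thesis using plus B by blast
      next
        case (2 \<Delta>'')
        then have "derives Mp {} (\<Delta>'' + {#Or A B#})"
          using B \<Delta>(2) derives_rule[OF Mp(4) rule_inst.par[of \<Delta>'' A B]] by (simp add: add_mset_commute)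
        then show ?thesis using 2 Or by (intro exI[of _ "\<Delta>'' + {#Or A B#}"]) simp
      qed
    qed
  next
    case And
    have "valid_sequent (\<Gamma>' + {#A#})" "valid_sequent (\<Gamma>' + {#B#})"
      using less.prems by (auto simp: And valid_sequent_def)
    then obtain \<Delta> \<Sigma> where \<Delta>: "\<Delta> \<subseteq># \<Gamma>' + {#A#}" "derives Mp {} \<Delta>"
      and \<Sigma>: "\<Sigma> \<subseteq># \<Gamma>' + {#B#}" "derives Mp {} \<Sigma>"
      using less.hyps[of "\<Gamma>' + {#A#}"] less.hyps[of "\<Gamma>' + {#B#}"] by (auto simp: And)
    show ?thesis
    proof (cases "\<Delta> \<subseteq># \<Gamma>' \<or> \<Sigma> \<subseteq># \<Gamma>'")
      case True
      then show ?thesis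
        using \<Delta>(2) \<Sigma>(2) And by (metis mset_subset_eq_add_left subset_mset.order_trans)
    next
      case False
      with \<Delta>(1) \<Sigma>(1) obtain \<Delta>' \<Sigma>' where "\<Delta> = \<Delta>' + {#A#}" "\<Sigma> = \<Sigma>' + {#B#}"
        and sub: "\<Delta>' \<subseteq># \<Gamma>'" "\<Sigma>' \<subseteq># \<Gamma>'"
        by (metis subseteq_mset_snocE)
      with \<Delta>(2) \<Sigma>(2) have "derives Mp {} (\<Delta>' \<union># \<Sigma>' + {#And A B#})"
        using derives_wedge_union[OF Mp(2)] by blast
      then show ?thesis using sub And by (intro exI[of _ "\<Delta>' \<union># \<Sigma>' + {#And A B#}"]) simp
    qed
  next
    case lit
    then show ?thesis
      using valid_literals_contain_axiom[OF less.prems] derives_rule[OF Mp(1) rule_inst.ax] by fastforce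
  qed
qed

lemma complete_Mp: "complete_system Mp"
  unfolding complete_system_def
proof (intro allI impI)
  fix A assume "valid A"
  then obtain \<Delta> where \<Delta>: "\<Delta> \<subseteq># {#A#}" "derives Mp {} \<Delta>"
    using Mp_derives_subsequent[of "{#A#}"] by (auto simp: valid_def valid_sequent_def)
  moreover have "\<Delta> \<noteq> {#}"
    \<comment> \<open>Soundness excludes the empty subsequent, so the whole of \<open>{#A#}\<close>
      is derivable.\<close>
    using restricted_sound[OF \<Delta>(2), of True True] by auto
  ultimately show "derives Mp {} {#A#}"
    using subseteq_mset_snocE[of \<Delta> "{#}" A] by auto
qed

section \<open>Incomplete systems\<close>

lemma incomplete_without_disjunction_rules:
  assumes "S \<inter> {Plus, Par} = {}"
  shows "\<not> complete_system S"
proof -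
  have "valid (Or (Pos 0) (Neg 0))" by (simp add: valid_def)
  moreover have "\<not> derives S {} {#Or (Pos 0) (Neg 0)#}"
    using restricted_sound[of S _ True False] assms by fastforce
  ultimately show ?thesis by (auto simp: complete_system_def)
qed

lemma incomplete_without_conjunction_rules:
  assumes "S \<inter> {Tensor, Wedge, With} = {}"
  shows "\<not> complete_system S"
proof -
  \<comment> \<open>With conjunctions counted as false, both disjuncts fail when the variable is
    true.\<close>
  let ?F = "Or (Neg 0) (And (Pos 0) (Pos 0))"
  have "valid ?F" by (simp add: valid_def)
  moreover have "\<not> derives S {} {#?F#}"
    using restricted_sound[of S "{#?F#}" False True "\<lambda>_. True"] assms by auto
  ultimately show ?thesis by (auto simp: complete_system_def)
qed

fun literals :: "formula \<Rightarrow> formula set" where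
  "literals (Pos p) = {Pos p}"
| "literals (Neg p) = {Neg p}"
| "literals (And A B) = literals A \<union> literals B"
| "literals (Or A B) = literals A \<union> literals B"

text \<open>Without \<open>Plus\<close> and \<open>Weak\<close>, the literals occurring in a derivable sequent are
  closed under complement.\<close>

lemma incomplete_without_plus_weak:
  assumes "S \<subseteq> {Ax, Tensor, Wedge, With, Par, Contr}"
  shows "\<not> complete_system S"
proof -
  \<comment> \<open>Validity comes from variable 0, while \<open>Pos 1\<close> occurs without its
    complement.\<close>
  let ?F = "Or (Pos 0) (Or (Neg 0) (Pos 1))"
  let ?I = "\<lambda>\<Gamma>. Pos 1 \<in> (\<Union>A \<in> set_mset \<Gamma>. literals A) \<longrightarrow> Neg 1 \<in> (\<Union>A \<in> set_mset \<Gamma>. literals A)"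
  have "?I {#?F#}" if "derives S {} {#?F#}"
    using that
  proof (rule derives_invariant[where I = ?I])
    fix r Ps \<Delta>
    assume "r \<in> S" and inst: "rule_inst r Ps \<Delta>" and prems: "\<And>P. P \<in> set Ps \<Longrightarrow> ?I P"
    from prems have "\<forall>P \<in> set Ps. ?I P" by blast
    \<comment> \<open>A conclusion has exactly the literals of its premises, so a premise supplying
      \<open>Pos 1\<close> supplies \<open>Neg 1\<close> too.\<close>
    with inst \<open>r \<in> S\<close> show "?I \<Delta>"
      using assms by cases auto
  qed simp
  moreover have "valid ?F" by (simp add: valid_def)
  ultimately show ?thesis by (auto simp: complete_system_def)
qed

text \<open>Each of the following three lemmas follows a backward proof search: \<open>Bad\<close> holds of the
  valid sequents it encounters, and every rule instance concluding one of these has a premise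
  that is again bad or is not valid.\<close>

lemma derives_not_bad:
  assumes "derives S {} \<Gamma>"
    and "\<And>r Ps \<Delta>. r \<in> S \<Longrightarrow> rule_inst r Ps \<Delta> \<Longrightarrow> Bad \<Delta> \<Longrightarrow>
           \<exists>P \<in> set Ps. Bad P \<or> \<not> valid_sequent P"
  shows "\<not> Bad \<Gamma>"
proof -
  from assms(1) have "valid_sequent \<Gamma> \<and> \<not> Bad \<Gamma>"
    by (rule derives_invariant) (use assms(2) rule_sound in blast)+
  then show ?thesis ..
qed

lemma not_valid_sequentI: "(\<And>A. A \<in># \<Gamma> \<Longrightarrow> \<not> holds v A) \<Longrightarrow> \<not> valid_sequent \<Gamma>"
  by (auto simp: valid_sequent_def)

lemma incomplete_without_par_contr:
  assumes "S \<subseteq> {Ax, Tensor, Wedge, With, Plus, Weak}"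
  shows "\<not> complete_system S"
proof -
  let ?F = "Or (Pos 0) (Neg 0)"
  have "\<not> derives S {} {#?F#}"
  proof
    assume "derives S {} {#?F#}"
    then have "\<not> {#?F#} = {#?F#}"
    proof (rule derives_not_bad[where Bad = "\<lambda>\<Gamma>. \<Gamma> = {#?F#}"])
      fix r Ps \<Delta>
      assume "r \<in> S" and inst: "rule_inst r Ps \<Delta>" and \<Delta>: "\<Delta> = {#?F#}"
      \<comment> \<open>\<open>Plus\<close> leaves a single literal, and \<open>Weak\<close> cannot
        conclude a singleton because its premise is nonempty.\<close>
      have invalid: "\<not> valid_sequent {#Pos 0#}" "\<not> valid_sequent {#Neg 0#}"
        by ((rule not_valid_sequentI[of _ "\<lambda>_. False"], force) |
        (rule not_valid_sequentI[of _ "\<lambda>_. True"], force))+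
      from inst \<open>r \<in> S\<close> \<Delta> show "\<exists>P \<in> set Ps. P = {#?F#} \<or> \<not> valid_sequent P"
        using assms invalid by cases auto
    qed
    then show False by simp
  qed
  moreover have "valid ?F" by (simp add: valid_def)
  ultimately show ?thesis by (auto simp: complete_system_def)
qed

lemma incomplete_multiplicative_weak:
  assumes "S \<subseteq> {Ax, Tensor, Plus, Par, Weak}"
  shows "\<not> complete_system S"
proof -
  let ?X = "And (Pos 0) (Pos 0)"
  let ?F = "Or (Neg 0) ?X"
  let ?Bad = "\<lambda>\<Gamma>. \<Gamma> = {#?F#} \<or> \<Gamma> = {#Neg 0, ?X#}"
  have singletons: "\<not> valid_sequent {#Pos 0#}" "\<not> valid_sequent {#?X#}" "\<not> valid_sequent {#Neg 0#}"
    by ((rule not_valid_sequentI[of _ "\<lambda>_. False"], force) |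
        (rule not_valid_sequentI[of _ "\<lambda>_. True"], force))+
  have "\<not> derives S {} {#?F#}"
  proof
    assume "derives S {} {#?F#}"
    then have "\<not> ?Bad {#?F#}"
    proof (rule derives_not_bad[where Bad = ?Bad])
      fix r Ps \<Delta>
      assume "r \<in> S" and inst: "rule_inst r Ps \<Delta>" and "?Bad \<Delta>"
      \<comment> \<open>\<open>Tensor\<close> gives \<open>Neg 0\<close> to one premise and leaves
        \<open>{#Pos 0#}\<close> as the other; \<open>Plus\<close> and \<open>Weak\<close> isolate
        one disjunct of \<open>?F\<close>.\<close>
      from inst \<open>r \<in> S\<close> \<open>?Bad \<Delta>\<close> show "\<exists>P \<in> set Ps. ?Bad P \<or> \<not> valid_sequent P"
        using assms singletons by cases (auto simp: add_eq_conv_ex union_is_single)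
    qed
    then show False by simp
  qed
  moreover have "valid ?F" by (simp add: valid_def)
  ultimately show ?thesis by (auto simp: complete_system_def)
qed

text \<open>The conjunction \<open>And (And P Q) P\<close> must be split multiplicatively at the root, but both
  premises need the formula \<open>Neg P\<close>.\<close>

lemma incomplete_multiplicative_additive:
  assumes "S \<subseteq> {Ax, Tensor, With, Plus, Par}"
  shows "\<not> complete_system S"
proof -
  let ?P = "Pos 0" and ?Q = "Pos 1" and ?P' = "Neg 0" and ?Q' = "Neg 1"
  let ?X = "And (And ?P ?Q) ?P"
  let ?Y = "Or ?X ?P'"
  let ?F = "Or ?Y ?Q'"
  \<comment> \<open>The last sequent is the right premise of \<open>With\<close>. It consists of
    three literals, so it is no axiom, and only weakening could remove \<open>?Q'\<close>.\<close>
  let ?Bad = "\<lambda>\<Gamma>. \<Gamma> = {#?F#} \<or> \<Gamma> = {#?Y, ?Q'#} \<or> \<Gamma> = {#?X, ?P', ?Q'#} \<or> \<Gamma> = {#?P, ?P', ?Q'#}"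
  have invalid: "\<not> valid_sequent {#?Y#}" "\<not> valid_sequent {#?Q'#}"
    "\<not> valid_sequent {#?X, ?Q'#}" "\<not> valid_sequent {#?P', ?Q'#}"
    by ((rule not_valid_sequentI[of _ "\<lambda>p. p = 0"], force) |
        (rule not_valid_sequentI[of _ "\<lambda>p. p = 1"], force) |
        (rule not_valid_sequentI[of _ "\<lambda>_. True"], force))+
  \<comment> \<open>The premise that lacks \<open>?P'\<close> is falsified by making only variable 1
    true.\<close>
  have split: "\<not> valid_sequent (add_mset (And ?P ?Q) \<Delta>) \<or> \<not> valid_sequent (add_mset ?P \<Sigma>)"
    if "\<Delta> + \<Sigma> = {#?P', ?Q'#}" for \<Delta> \<Sigma>
  proof -
    have sub: "set_mset \<Delta> \<subseteq> {?P', ?Q'}" "set_mset \<Sigma> \<subseteq> {?P', ?Q'}"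
      using arg_cong[OF that, of set_mset] by auto
    have "?P' \<notin># \<Delta> \<or> ?P' \<notin># \<Sigma>"
      using arg_cong[OF that, of "\<lambda>\<Gamma>. count \<Gamma> ?P'"] by (auto simp flip: count_greater_zero_iff)
    then show ?thesis
      using sub not_valid_sequentI[of "add_mset (And ?P ?Q) \<Delta>" "\<lambda>p. p = 1"]
        not_valid_sequentI[of "add_mset ?P \<Sigma>" "\<lambda>p. p = 1"] by fastforce
  qed
  have "\<not> derives S {} {#?F#}"
  proof
    assume "derives S {} {#?F#}"
    then have "\<not> ?Bad {#?F#}"
    proof (rule derives_not_bad[where Bad = ?Bad])
      fix r Ps \<Delta>
      assume "r \<in> S" and inst: "rule_inst r Ps \<Delta>" and "?Bad \<Delta>"
      from inst show "\<exists>P \<in> set Ps. ?Bad P \<or> \<not> valid_sequent P"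
      proof cases
        case (tensor \<Delta>' A \<Sigma> B)
        with \<open>?Bad \<Delta>\<close> have "A = And ?P ?Q" "B = ?P" "\<Delta>' + \<Sigma> = {#?P', ?Q'#}"
          by (simp_all add: add_eq_conv_ex)
        with split tensor show ?thesis by auto
      next
        case (with_and \<Gamma> A B)
        with \<open>?Bad \<Delta>\<close> have "B = ?P" "\<Gamma> = {#?P', ?Q'#}"
          by (simp_all add: add_eq_conv_ex)
        with with_and show ?thesis by auto
      next
        case (plus1 \<Gamma> A B)
        with \<open>?Bad \<Delta>\<close> have "\<Gamma> = {#} \<and> A = ?Y \<or> \<Gamma> = {#?Q'#} \<and> A = ?X"
          by (simp add: add_eq_conv_ex) (elim conjE disjE exE; simp)
        with plus1 invalid show ?thesis by auto
      next
        case (plus2 \<Gamma> B A)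
        with \<open>?Bad \<Delta>\<close> have "\<Gamma> = {#} \<and> B = ?Q' \<or> \<Gamma> = {#?Q'#} \<and> B = ?P'"
          by (simp add: add_eq_conv_ex) (elim conjE disjE exE; simp)
        with plus2 invalid show ?thesis by auto
      next
        case (par \<Gamma> A B)
        with \<open>?Bad \<Delta>\<close> have "\<Gamma> = {#} \<and> A = ?Y \<and> B = ?Q' \<or> \<Gamma> = {#?Q'#} \<and> A = ?X \<and> B = ?P'"
          by (simp add: add_eq_conv_ex)
        then show ?thesis by (elim disjE conjE) (simp_all add: par(2))
      next
        case (ax p)
        with \<open>?Bad \<Delta>\<close> show ?thesis
          by (simp add: add_eq_conv_ex)
      qed (use assms \<open>r \<in> S\<close> in auto)
    qed
    then show False by simp
  qed
  moreover have "valid ?F" by (auto simp: valid_def)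
  ultimately show ?thesis by (auto simp: complete_system_def)
qed

text \<open>Without weakening and context splitting, sequents have at most two formulas. They are
  interpreted in the ortholattice with six elements, in which
  \<open>Atom i True\<close> and \<open>Atom i False\<close> are complementary for each \<open>i\<close>.\<close>

datatype mo2 = Bot | Top | Atom bool bool

text \<open>Distributivity fails here because atoms from different pairs meet in \<open>Bot\<close>
  and join in \<open>Top\<close>.\<close>

fun meet :: "mo2 \<Rightarrow> mo2 \<Rightarrow> mo2" where
  "meet Top y = y"
| "meet x Top = x"
| "meet x y = (if x = y then x else Bot)"

fun join :: "mo2 \<Rightarrow> mo2 \<Rightarrow> mo2" where
  "join Bot y = y"
| "join x Bot = x"
| "join x y = (if x = y then x else Top)"

text \<open>\<open>cover x y\<close>: the complement of \<open>x\<close> lies below \<open>y\<close>.\<close>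

fun cover :: "mo2 \<Rightarrow> mo2 \<Rightarrow> bool" where
  "cover Top y \<longleftrightarrow> True"
| "cover Bot y \<longleftrightarrow> y = Top"
| "cover (Atom i s) y \<longleftrightarrow> y = Atom i (\<not> s) \<or> y = Top"

lemma cover_commute: "cover x y \<longleftrightarrow> cover y x"
  by (cases x; cases y) auto

lemma cover_meet: "cover x (meet y z) \<longleftrightarrow> cover x y \<and> cover x z"
  by (cases x; cases y; cases z) auto

lemma cover_join1: "cover x y \<Longrightarrow> cover x (join y z)"
  by (cases x; cases y; cases z) auto

lemma cover_join2: "cover x z \<Longrightarrow> cover x (join y z)"
  by (cases x; cases y; cases z) auto

text \<open>Serves \<open>Contr\<close>: an element above its own complement is above their join,
  which is \<open>Top\<close>.\<close>

lemma cover_self_iff: "cover x x \<longleftrightarrow> x = Top"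
  by (cases x) auto

lemma meet_eq_Top_iff: "meet x y = Top \<longleftrightarrow> x = Top \<and> y = Top"
  by (cases x; cases y) auto

lemma join_Top: "join Top x = Top" "join x Top = Top"
  by (cases x; simp)+

text \<open>Serves \<open>Par\<close>: the join lies above both \<open>x\<close> and its
  complement.\<close>

lemma join_eq_Top_if_cover:
  assumes "cover x y"
  shows "join x y = Top" "join y x = Top"
  using assms by (cases x; cases y; simp)+

text \<open>Variable 0 uses one complementary pair of atoms; all other variables share the
  second.\<close>

fun mo2_value :: "formula \<Rightarrow> mo2" where
  "mo2_value (Pos p) = Atom (p = 0) True"
| "mo2_value (Neg p) = Atom (p = 0) False"
| "mo2_value (And A B) = meet (mo2_value A) (mo2_value B)"
| "mo2_value (Or A B) = join (mo2_value A) (mo2_value B)"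

text \<open>For two formulas this is stronger than a join equal to \<open>Top\<close>, which
  \<open>With\<close> would not preserve.\<close>

definition mo2_valid :: "sequent \<Rightarrow> bool" where
  "mo2_valid \<Gamma> \<longleftrightarrow> (\<exists>A. \<Gamma> = {#A#} \<and> mo2_value A = Top) \<or>
     (\<exists>A B. \<Gamma> = {#A, B#} \<and> cover (mo2_value A) (mo2_value B))"

lemma mo2_valid_add_mset:
  "mo2_valid (add_mset A \<Gamma>) \<longleftrightarrow> \<Gamma> = {#} \<and> mo2_value A = Top \<or>
     (\<exists>B. \<Gamma> = {#B#} \<and> cover (mo2_value B) (mo2_value A))"
  unfolding mo2_valid_def using cover_commute by (auto simp: add_eq_conv_ex)

lemma incomplete_additive_contr:
  assumes "S \<subseteq> {Ax, With, Plus, Par, Contr}"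
  shows "\<not> complete_system S"
proof -
  \<comment> \<open>Classically valid by distributivity; here both conjunctions take the value
    \<open>Bot\<close>, leaving the atom of \<open>Neg 0\<close>.\<close>
  let ?F = "Or (And (Pos 0) (Pos 1)) (Or (And (Pos 0) (Neg 1)) (Neg 0))"
  have "mo2_valid \<Gamma>" if "derives S {} \<Gamma>" for \<Gamma>
    using that
  proof (rule derives_invariant)
    fix r Ps \<Delta>
    assume "r \<in> S" and inst: "rule_inst r Ps \<Delta>" and prems: "\<And>P. P \<in> set Ps \<Longrightarrow> mo2_valid P"
    then have "\<forall>P \<in> set Ps. mo2_valid P" by blast
    with inst \<open>r \<in> S\<close> show "mo2_valid \<Delta>"
      using assms
      by cases (auto simp: mo2_valid_add_mset cover_meet cover_join1 cover_join2 cover_self_iff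
          meet_eq_Top_iff join_Top join_eq_Top_if_cover)
  qed simp
  moreover have "\<not> mo2_valid {#?F#}" by (simp add: mo2_valid_add_mset)
  moreover have "valid ?F" by (auto simp: valid_def)
  ultimately show ?thesis by (auto simp: complete_system_def)
qed

section \<open>Classification\<close>

lemma complete_contains_Mp:
  assumes "extended_system S" and "complete_system S"
  shows "contains S Mp"
proof (rule contains_MpI)
  show "Ax \<in> S" using assms(1) by (auto simp: extended_system_def)
  have rules: "S \<subseteq> {Ax, Tensor, Wedge, With, Plus, Par, Contr, Weak}"
    using assms(1) by (auto simp: extended_system_def)
  have "S \<inter> {Plus, Par} \<noteq> {}" and "\<not> S \<subseteq> {Ax, Tensor, Wedge, With, Par, Contr}"
    using assms(2) incomplete_without_disjunction_rules incomplete_without_plus_weak by blast+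
  then show "Plus \<in> S \<or> Par \<in> S \<and> Weak \<in> S"
    using rules by blast
  have "\<not> S \<subseteq> {Ax, Tensor, Wedge, With, Plus, Weak}"
    using assms(2) incomplete_without_par_contr by blast
  with \<open>S \<inter> {Plus, Par} \<noteq> {}\<close> show "Par \<in> S \<or> Plus \<in> S \<and> Contr \<in> S"
    using rules by blast
  have "Tensor \<in> S \<or> Wedge \<in> S \<or> With \<in> S"
    using assms(2) incomplete_without_conjunction_rules by blast
  moreover have "Wedge \<in> S \<or> With \<in> S \<or> Contr \<in> S"
    using assms(2) incomplete_multiplicative_weak[of S] rules by blast
  moreover have "Wedge \<in> S \<or> Contr \<in> S \<or> Weak \<in> S"
    using assms(2) incomplete_multiplicative_additive[of S] rules by blast
  moreover have "Wedge \<in> S \<or> Tensor \<in> S \<or> Weak \<in> S"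
    using assms(2) incomplete_additive_contr[of S] rules by blast
  \<comment> \<open>Without \<open>Wedge\<close>, the absence of \<open>With\<close> or of
    \<open>Weak\<close> forces both \<open>Tensor\<close> and \<open>Contr\<close>.\<close>
  ultimately show "Wedge \<in> S \<or> With \<in> S \<and> Weak \<in> S \<or> Tensor \<in> S \<and> Contr \<in> S"
    by blast
qed

lemma named_contains_Mp:
  "T \<in> {GS1p, Pp, Np, Mp} \<Longrightarrow> contains T Mp"
  by (rule contains_MpI) (auto simp: GS1p_def Pp_def Np_def Mp_def)

text \<open>Apart from \<open>Weak\<close>, a rule either concludes a sequent with a compound
  formula or a negative literal, or is \<open>Contr\<close>, which keeps the set of
  formulas.\<close>

lemma weak_not_derivable:
  assumes "rule_derivable S Weak"
  shows "Weak \<in> S"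
proof (rule ccontr)
  assume "Weak \<notin> S"
  let ?I = "\<lambda>\<Gamma>. set_mset \<Gamma> \<subseteq> range Pos \<longrightarrow> set_mset \<Gamma> \<subseteq> {Pos 0}"
  have "derives S {{#Pos 0#}} {#Pos 0, Pos 1#}"
    using derives_rule[OF assms rule_inst.weak[of "{#Pos 0#}" "Pos 1"]]
    by (simp add: derives.leaf add_mset_commute)
  then have "?I {#Pos 0, Pos 1#}"
  proof (rule derives_invariant)
    fix r Ps \<Delta>
    assume "r \<in> S" and inst: "rule_inst r Ps \<Delta>" and prems: "\<And>P. P \<in> set Ps \<Longrightarrow> ?I P"
    from inst \<open>r \<in> S\<close> \<open>Weak \<notin> S\<close> prems show "?I \<Delta>"
      by cases auto
  qed simp
  then show False by simp
qed

text \<open>Only \<open>Contr\<close> can conclude a single positive literal: \<open>Ax\<close> and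
  \<open>Weak\<close> conclude at least two formulas, the other rules a compound one.\<close>

lemma contr_not_derivable:
  assumes "rule_derivable S Contr"
  shows "Contr \<in> S"
proof (rule ccontr)
  assume "Contr \<notin> S"
  have "derives S {{#Pos 0, Pos 0#}} {#Pos 0#}"
    using derives_rule[OF assms rule_inst.contr[of "{#}" "Pos 0"]] by (simp add: derives.leaf)
  then have "{#Pos 0#} \<noteq> {#Pos 0#}"
  proof (rule derives_invariant[where I = "\<lambda>\<Gamma>. \<Gamma> \<noteq> {#Pos 0#}"])
    fix r Ps \<Delta>
    assume "r \<in> S" and inst: "rule_inst r Ps \<Delta>"
    from inst \<open>r \<in> S\<close> \<open>Contr \<notin> S\<close> show "\<Delta> \<noteq> {#Pos 0#}"
      by cases auto
  qed simp
  then show False by simp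
qed

lemma equivalent_if_contains_Mp:
  assumes "contains S Mp" and "contains T Mp" and "S \<inter> {Contr, Weak} = T \<inter> {Contr, Weak}"
  shows "equivalent S T"
  using assms by (auto simp: equivalent_def intro!: contains_if_contains_Mp)

lemma equivalent_structural_rules:
  assumes "equivalent S T"
  shows "S \<inter> {Contr, Weak} = T \<inter> {Contr, Weak}"
  using assms weak_not_derivable contr_not_derivable by (auto simp: equivalent_def contains_def)

theorem theorem23:
  "(\<forall>S \<in> {GS1p, Pp, Np, Mp}. extended_system S \<and> complete_system S) \<and>
   (\<forall>S. extended_system S \<and> complete_system S \<longrightarrow>
        (\<exists>T \<in> {GS1p, Pp, Np, Mp}. equivalent S T)) \<and>
   \<not> equivalent GS1p Pp \<and> \<not> equivalent GS1p Np \<and> \<not> equivalent GS1p Mp \<and>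
   \<not> equivalent Pp Np \<and> \<not> equivalent Pp Mp \<and> \<not> equivalent Np Mp"
proof (intro conjI)
  show "\<forall>S \<in> {GS1p, Pp, Np, Mp}. extended_system S \<and> complete_system S"
  proof
    fix S assume S: "S \<in> {GS1p, Pp, Np, Mp}"
    then have "extended_system S"
      unfolding extended_system_def
      by (intro exI[of _ "S - {Ax}"]) (auto simp: GS1p_def Pp_def Np_def Mp_def)
    moreover have "complete_system S"
      using S named_contains_Mp complete_Mp contains_complete by blast
    ultimately show "extended_system S \<and> complete_system S" ..
  qed
  show "\<forall>S. extended_system S \<and> complete_system S \<longrightarrow> (\<exists>T \<in> {GS1p, Pp, Np, Mp}. equivalent S T)"
  proof (intro allI impI)
    fix S assume "extended_system S \<and> complete_system S"
    then have "contains S Mp" using complete_contains_Mp by blast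
    \<comment> \<open>The four named systems realise the four subsets of
      \<open>{Contr, Weak}\<close>, each exactly once.\<close>
    have "\<exists>T \<in> {GS1p, Pp, Np, Mp}. S \<inter> {Contr, Weak} = T \<inter> {Contr, Weak}"
      by (cases "Contr \<in> S"; cases "Weak \<in> S") (simp_all add: GS1p_def Pp_def Np_def Mp_def)
    then obtain T where T: "T \<in> {GS1p, Pp, Np, Mp}" "S \<inter> {Contr, Weak} = T \<inter> {Contr, Weak}" ..
    have "equivalent S T"
      by (rule equivalent_if_contains_Mp[OF \<open>contains S Mp\<close> named_contains_Mp[OF T(1)] T(2)])
    with T(1) show "\<exists>T \<in> {GS1p, Pp, Np, Mp}. equivalent S T" ..
  qed
qed (auto dest: equivalent_structural_rules simp: GS1p_def Pp_def Np_def Mp_def)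

end
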